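(* Let $R$ be a ring (unital and associative, not necessarily commutative). Let $n\in\mathbb{N}$ and $p\in\{0,1,\ldots,n\}$. Let $h_{k,\,i}$ be an element of $R$ for all $k\in\mathbb{Z}$ and $i\in[n]$. For any $\alpha\in\mathbb{Z}^n$, define $$t_\alpha:=\operatorname{rowdet}\left(\left(h_{\alpha_i+j,\,i}\right)_{i,j\in[n]}\right)\in R.$$ Let $\xi$ be the $n$-tuple $$(1,2,\ldots,n)+(\underbrace{0,0,\ldots,0}_{n-p\text{ zeroes}},\underbrace{1,1,\ldots,1}_{p\text{ ones}})=(1,2,\ldots,n-p,\,n-p+2,\,n-p+3,\ldots,n+1)\in\mathbb{Z}^n.$$ Let $\alpha\in\mathbb{Z}^n$. Then $$\sum_{\substack{\beta\in\{0,1\}^n;\\ |\beta|=p}}t_{\alpha+\beta}=\operatorname{rowdet}\left(\left(h_{\alpha_i+\xi_j,\,i}\right)_{i,j\in[n]}\right).$$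
   Context: $\mathbb{N}=\{0,1,2,\ldots\}$ and $[n]=\{1,2,\ldots,n\}$. For an $n$-tuple $\alpha$, $\alpha_i$ denotes its $i$-th entry, and for $\alpha\in\mathbb{Z}^n$ we set $|\alpha|:=\alpha_1+\alpha_2+\cdots+\alpha_n$. Addition of $n$-tuples is entrywise. $S_n$ is the group of permutations of $[n]$, and $(-1)^\sigma$ is the sign of $\sigma\in S_n$. For an $n\times n$-matrix $A=(a_{i,j})_{i,j\in[n]}$ over $R$ (whose $(i,j)$-th entry is $a_{i,j}$), the row-determinant is $$\operatorname{rowdet}A:=\sum_{\sigma\in S_n}(-1)^\sigma a_{1,\sigma(1)}a_{2,\sigma(2)}\cdots a_{n,\sigma(n)}\in R$$ (factors multiplied in this order). *)

theory Defs
  imports "HOL-Combinatorics.Permutations" "HOL-Library.FuncSet"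
begin

text \<open>
  An \<open>n\<close>-tuple is a function on \<open>nat\<close> and an \<open>n \<times> n\<close> matrix a binary function on \<open>nat\<close>;
  only indices in \<open>{1..n}\<close> matter.

  The sort \<open>{ring, monoid_mult}\<close> is that of unital associative rings, the zero ring
  included (class \<open>ring_1\<close> would demand \<open>0 \<noteq> 1\<close>). As \<open>of_int\<close> is not available in this sort,
  the sign of a permutation acts by a case distinction.
\<close>

definition rowdet :: "nat \<Rightarrow> (nat \<Rightarrow> nat \<Rightarrow> 'a) \<Rightarrow> 'a::{ring, monoid_mult}" where
  "rowdet n A =
    (\<Sum>\<sigma> | \<sigma> permutes {1..n}.
      let x = prod_list (map (\<lambda>i. A i (\<sigma> i)) [1..<Suc n])
      in if sign \<sigma> = 1 then x else - x)"

definition tdet :: "nat \<Rightarrow> (int \<Rightarrow> nat \<Rightarrow> 'a) \<Rightarrow> (nat \<Rightarrow> int) \<Rightarrow> 'a::{ring, monoid_mult}" where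
  "tdet n h \<alpha> = rowdet n (\<lambda>i j. h (\<alpha> i + int j) i)"

definition xi :: "nat \<Rightarrow> nat \<Rightarrow> nat \<Rightarrow> int" where
  "xi n p j = int j + (if j \<le> n - p then 0 else 1)"

end

theory Submission
  imports Defs
begin

text \<open>
  Encode \<open>\<beta>\<close> by its support \<open>B\<close>. In the summand of \<open>\<sigma>\<close>, raising the rows in \<open>B\<close> has the same effect
  as raising the columns in \<open>S = \<sigma> ` B\<close>, so the left-hand side is the sum over all \<open>p\<close>-element sets
  \<open>S\<close> of the row-determinant of the matrix with the columns in \<open>S\<close> raised. If some \<open>j \<in> S\<close> has
  \<open>j < n\<close> and \<open>j + 1 \<notin> S\<close>, then columns \<open>j\<close> and \<open>j + 1\<close> of that matrix agree and its
  row-determinant vanishes (which, unlike for rows, needs no commutativity). The only surviving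
  \<open>S\<close> consists of the last \<open>p\<close> columns.
\<close>

definition rowdet_term :: "nat \<Rightarrow> (nat \<Rightarrow> nat \<Rightarrow> 'a) \<Rightarrow> (nat \<Rightarrow> nat) \<Rightarrow> 'a::{ring, monoid_mult}" where
  "rowdet_term n A \<sigma> =
    (let x = prod_list (map (\<lambda>i. A i (\<sigma> i)) [1..<Suc n]) in if sign \<sigma> = 1 then x else - x)"

lemma rowdet_eq_sum_terms: "rowdet n A = (\<Sum>\<sigma> | \<sigma> permutes {1..n}. rowdet_term n A \<sigma>)"
  by (simp add: rowdet_def rowdet_term_def)

lemma rowdet_term_cong:
  assumes "\<And>i. i \<in> {1..n} \<Longrightarrow> A i (\<sigma> i) = B i (\<sigma> i)"
  shows "rowdet_term n A \<sigma> = rowdet_term n B \<sigma>"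
proof -
  have "map (\<lambda>i. A i (\<sigma> i)) [1..<Suc n] = map (\<lambda>i. B i (\<sigma> i)) [1..<Suc n]"
    using assms by (intro map_cong) auto
  then show ?thesis by (simp only: rowdet_term_def)
qed

lemma rowdet_cong:
  assumes "\<And>i j. i \<in> {1..n} \<Longrightarrow> j \<in> {1..n} \<Longrightarrow> A i j = B i j"
  shows "rowdet n A = rowdet n B"
  unfolding rowdet_eq_sum_terms
  by (intro sum.cong refl rowdet_term_cong assms) (auto dest: permutes_in_image)

lemma rowdet_equal_columns:
  fixes A :: "nat \<Rightarrow> nat \<Rightarrow> 'a::{ring, monoid_mult}"
  assumes j: "j \<in> {1..n}" and k: "k \<in> {1..n}" and jk: "j \<noteq> k"
    and eq: "\<And>i. i \<in> {1..n} \<Longrightarrow> A i j = A i k"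
  shows "rowdet n A = 0"
proof -
  let ?\<tau> = "transpose j k"
  let ?E = "{\<sigma>. \<sigma> permutes {1..n} \<and> sign \<sigma> = 1}"
  let ?O = "{\<sigma>. \<sigma> permutes {1..n} \<and> sign \<sigma> \<noteq> 1}"
  have \<tau>: "?\<tau> permutes {1..n}"
    using j k by (rule permutes_swap_id)
  have sign\<tau>: "sign (?\<tau> \<circ> \<sigma>) = - sign \<sigma>" if "\<sigma> permutes {1..n}" for \<sigma>
    using permutes_imp_permutation[OF finite_atLeastAtMost that] jk
    by (simp add: sign_compose sign_swap_id permutation_swap_id)
  have perm: "?\<tau> \<circ> \<sigma> permutes {1..n}" if "\<sigma> permutes {1..n}" for \<sigma>
    using that \<tau> by (rule permutes_compose)
  have invol: "?\<tau> \<circ> (?\<tau> \<circ> \<sigma>) = \<sigma>" for \<sigma>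
    by (simp add: fun_eq_iff)
  have pm: "sign \<sigma> = - 1" if "sign \<sigma> \<noteq> 1" for \<sigma> :: "nat \<Rightarrow> nat"
    using that by (cases \<sigma> rule: sign_cases) simp_all
  have bij: "bij_betw (\<lambda>\<sigma>. ?\<tau> \<circ> \<sigma>) ?E ?O"
    by (rule bij_betwI[where g = "\<lambda>\<sigma>. ?\<tau> \<circ> \<sigma>"]) (use pm in \<open>auto simp: perm sign\<tau> invol simp del: One_nat_def\<close>)
  have neg: "rowdet_term n A (?\<tau> \<circ> \<sigma>) = - rowdet_term n A \<sigma>" if "\<sigma> \<in> ?E" for \<sigma>
  proof -
    have "A i ((?\<tau> \<circ> \<sigma>) i) = A i (\<sigma> i)" if "i \<in> {1..n}" for i
      using eq[OF that] by (auto simp: transpose_def)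
    then have "map (\<lambda>i. A i ((?\<tau> \<circ> \<sigma>) i)) [1..<Suc n] = map (\<lambda>i. A i (\<sigma> i)) [1..<Suc n]"
      by (intro map_cong) auto
    then show ?thesis
      using that by (simp only: rowdet_term_def) (simp add: sign\<tau>)
  qed
  have fin: "finite {\<sigma>. \<sigma> permutes {1..n}}"
    by (rule finite_permutations) simp
  have "rowdet n A = (\<Sum>\<sigma>\<in>?E \<union> ?O. rowdet_term n A \<sigma>)"
    unfolding rowdet_eq_sum_terms by (rule sum.cong) auto
  also have "\<dots> = (\<Sum>\<sigma>\<in>?E. rowdet_term n A \<sigma>) + (\<Sum>\<sigma>\<in>?O. rowdet_term n A \<sigma>)"
    by (rule sum.union_disjoint) (auto intro: finite_subset[OF _ fin])
  also have "(\<Sum>\<sigma>\<in>?O. rowdet_term n A \<sigma>) = (\<Sum>\<sigma>\<in>?E. rowdet_term n A (?\<tau> \<circ> \<sigma>))"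
    by (rule sum.reindex_bij_betw[OF bij, symmetric])
  also have "\<dots> = - (\<Sum>\<sigma>\<in>?E. rowdet_term n A \<sigma>)"
    using neg by (simp add: sum_negf)
  finally show ?thesis by simp
qed

lemma bij_betw_image_card_subsets:
  assumes "bij_betw f X Y"
  shows "bij_betw ((`) f) {B. B \<subseteq> X \<and> card B = p} {S. S \<subseteq> Y \<and> card S = p}"
proof (rule bij_betw_byWitness[where f' = "(`) (inv_into X f)"])
  have inj: "inj_on f X" and im: "f ` X = Y"
    using assms by (auto simp: bij_betw_def)
  have inj': "inj_on (inv_into X f) Y" and im': "inv_into X f ` Y = X"
    using bij_betw_inv_into[OF assms] by (auto simp: bij_betw_def)
  show "\<forall>B\<in>{B. B \<subseteq> X \<and> card B = p}. inv_into X f ` f ` B = B"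
    using inj by (simp add: inv_into_image_cancel)
  show "\<forall>S\<in>{S. S \<subseteq> Y \<and> card S = p}. f ` inv_into X f ` S = S"
    using im by (simp add: image_inv_into_cancel)
  show "(`) f ` {B. B \<subseteq> X \<and> card B = p} \<subseteq> {S. S \<subseteq> Y \<and> card S = p}"
    using im by (auto simp: card_image inj_on_subset[OF inj])
  show "(`) (inv_into X f) ` {S. S \<subseteq> Y \<and> card S = p} \<subseteq> {B. B \<subseteq> X \<and> card B = p}"
    using im' by (auto simp: card_image inj_on_subset[OF inj'])
qed

lemma bij_betw_indicator_card_subsets:
  fixes I :: "'b set"
  assumes "finite I"
  shows "bij_betw (\<lambda>B. restrict (\<lambda>i. of_bool (i \<in> B)) I)
     {B. B \<subseteq> I \<and> card B = p}
     {\<beta>. \<beta> \<in> I \<rightarrow>\<^sub>E {0, 1::int} \<and> sum \<beta> I = int p}"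
proof (rule bij_betw_byWitness[where f' = "\<lambda>\<beta>. {i \<in> I. \<beta> i = 1}"])
  have count: "sum (\<lambda>i. of_bool (i \<in> B)) I = int (card (I \<inter> B))" for B
    using assms by (simp add: of_bool_def sum.If_cases Int_def)
  show "\<forall>B\<in>{B. B \<subseteq> I \<and> card B = p}. {i \<in> I. restrict (\<lambda>i. of_bool (i \<in> B)) I i = (1::int)} = B"
    by auto
  have ext: "restrict (\<lambda>i. of_bool (i \<in> {i \<in> I. \<beta> i = 1})) I = \<beta>" if "\<beta> \<in> I \<rightarrow>\<^sub>E {0, 1::int}" for \<beta>
    using that by (fastforce simp: fun_eq_iff PiE_def extensional_def Pi_def)
  then show "\<forall>\<beta>\<in>{\<beta>. \<beta> \<in> I \<rightarrow>\<^sub>E {0, 1::int} \<and> sum \<beta> I = int p}.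
      restrict (\<lambda>i. of_bool (i \<in> {i \<in> I. \<beta> i = 1})) I = \<beta>"
    by blast
  show "(\<lambda>B. restrict (\<lambda>i. of_bool (i \<in> B)) I) ` {B. B \<subseteq> I \<and> card B = p}
      \<subseteq> {\<beta>. \<beta> \<in> I \<rightarrow>\<^sub>E {0, 1::int} \<and> sum \<beta> I = int p}"
    by (auto simp: count Int_absorb1)
  show "(\<lambda>\<beta>. {i \<in> I. \<beta> i = 1}) ` {\<beta>. \<beta> \<in> I \<rightarrow>\<^sub>E {0, 1::int} \<and> sum \<beta> I = int p}
      \<subseteq> {B. B \<subseteq> I \<and> card B = p}"
  proof clarify
    fix \<beta> assume \<beta>: "\<beta> \<in> I \<rightarrow>\<^sub>E {0, 1::int}" and s: "sum \<beta> I = int p"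
    have "sum \<beta> I = sum (\<lambda>i. of_bool (i \<in> {i \<in> I. \<beta> i = 1})) I"
      using \<beta> by (intro sum.cong refl) auto
    also have "\<dots> = int (card (I \<inter> {i \<in> I. \<beta> i = 1}))" by (rule count)
    also have "I \<inter> {i \<in> I. \<beta> i = 1} = {i \<in> I. \<beta> i = 1}" by blast
    finally show "{i \<in> I. \<beta> i = 1} \<subseteq> I \<and> card {i \<in> I. \<beta> i = 1} = p"
      using s by auto
  qed
qed

lemma upward_closed_subset_eq:
  fixes n :: nat
  assumes S: "S \<subseteq> {1..n}" and closed: "\<And>j. j \<in> S \<Longrightarrow> j < n \<Longrightarrow> Suc j \<in> S"
  shows "S = {Suc (n - card S)..n}"
proof (cases "S = {}")
  case False
  have fin: "finite S" using S by (rule finite_subset) simp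
  let ?m = "Min S"
  have m: "?m \<in> S" using fin False by simp
  have up: "?m + d \<le> n \<Longrightarrow> ?m + d \<in> S" for d
    by (induction d) (use m closed in auto)
  have "S = {?m..n}"
  proof
    show "S \<subseteq> {?m..n}" using S fin by auto
    show "{?m..n} \<subseteq> S" by (metis up atLeastAtMost_iff le_add_diff_inverse subsetI)
  qed
  moreover from this have "card S = Suc n - ?m" by (metis card_atLeastAtMost)
  moreover have "1 \<le> ?m" "?m \<le> n" using m S by auto
  ultimately show ?thesis by simp
qed simp

theorem theorem4p1:
  fixes h :: "int \<Rightarrow> nat \<Rightarrow> 'a::{ring, monoid_mult}"
    and n p :: nat
    and \<alpha> :: "nat \<Rightarrow> int"
  assumes "p \<le> n"
  shows "(\<Sum>\<beta> | \<beta> \<in> {1..n} \<rightarrow>\<^sub>E {0, 1} \<and> (\<Sum>i=1..n. \<beta> i) = int p.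
            tdet n h (\<lambda>i. \<alpha> i + \<beta> i)) =
         rowdet n (\<lambda>i j. h (\<alpha> i + xi n p j) i)"
proof -
  let ?P = "{S. S \<subseteq> {1..n} \<and> card S = p}"
  let ?L = "{Suc (n - p)..n}"
  define rows where "rows B = (\<lambda>i j. h (\<alpha> i + of_bool (i \<in> B) + int j) i)" for B
  define cols where "cols S = (\<lambda>i j. h (\<alpha> i + of_bool (j \<in> S) + int j) i)" for S
  have "(\<Sum>\<beta> | \<beta> \<in> {1..n} \<rightarrow>\<^sub>E {0, 1} \<and> (\<Sum>i=1..n. \<beta> i) = int p. tdet n h (\<lambda>i. \<alpha> i + \<beta> i))
      = (\<Sum>B\<in>?P. tdet n h (\<lambda>i. \<alpha> i + restrict (\<lambda>i. of_bool (i \<in> B)) {1..n} i))"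
    by (rule sum.reindex_bij_betw[OF bij_betw_indicator_card_subsets, symmetric]) simp
  also have "\<dots> = (\<Sum>B\<in>?P. rowdet n (rows B))"
    unfolding tdet_def rows_def by (intro sum.cong refl rowdet_cong) simp
  also have "\<dots> = (\<Sum>\<sigma> | \<sigma> permutes {1..n}. \<Sum>B\<in>?P. rowdet_term n (rows B) \<sigma>)"
    unfolding rowdet_eq_sum_terms by (rule sum.swap)
  also have "\<dots> = (\<Sum>\<sigma> | \<sigma> permutes {1..n}. \<Sum>S\<in>?P. rowdet_term n (cols S) \<sigma>)"
  proof (rule sum.cong[OF refl])
    fix \<sigma> assume "\<sigma> \<in> {\<sigma>. \<sigma> permutes {1..n}}"
    then have \<sigma>: "\<sigma> permutes {1..n}" by simp
    have "rows B i (\<sigma> i) = cols (\<sigma> ` B) i (\<sigma> i)" for B i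
      by (simp add: rows_def cols_def inj_image_mem_iff[OF permutes_inj[OF \<sigma>]])
    then have "(\<Sum>B\<in>?P. rowdet_term n (rows B) \<sigma>) = (\<Sum>B\<in>?P. rowdet_term n (cols (\<sigma> ` B)) \<sigma>)"
      by (intro sum.cong refl rowdet_term_cong)
    also have "\<dots> = (\<Sum>S\<in>?P. rowdet_term n (cols S) \<sigma>)"
      by (rule sum.reindex_bij_betw[OF bij_betw_image_card_subsets[OF permutes_imp_bij[OF \<sigma>]]])
    finally show "(\<Sum>B\<in>?P. rowdet_term n (rows B) \<sigma>) = (\<Sum>S\<in>?P. rowdet_term n (cols S) \<sigma>)" .
  qed
  also have "\<dots> = (\<Sum>S\<in>?P. rowdet n (cols S))"
    unfolding rowdet_eq_sum_terms by (rule sum.swap)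
  also have "\<dots> = (\<Sum>S\<in>{?L}. rowdet n (cols S))"
  proof (rule sum.mono_neutral_right)
    show "finite ?P" by simp
    show "{?L} \<subseteq> ?P" using assms by auto
    show "\<forall>S\<in>?P - {?L}. rowdet n (cols S) = 0"
    proof
      fix S assume S: "S \<in> ?P - {?L}"
      then obtain j where j: "j \<in> S" "j < n" "Suc j \<notin> S"
        using upward_closed_subset_eq[of S n] by auto
      show "rowdet n (cols S) = 0"
      proof (rule rowdet_equal_columns)
        show "j \<in> {1..n}" "Suc j \<in> {1..n}" "j \<noteq> Suc j" using j S by auto
        show "cols S i j = cols S i (Suc j)" for i
          using j by (simp add: cols_def add_ac)
      qed
    qed
  qed
  also have "\<dots> = rowdet n (\<lambda>i j. h (\<alpha> i + xi n p j) i)"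
    unfolding cols_def by (simp, intro rowdet_cong) (auto simp: xi_def add_ac)
  finally show ?thesis .
qed

end
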